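(* Let $R\subseteq\mathbb{R}^n$ be a nonempty polyhedron, $A\in\mathbb{R}^{m\times n}$, and $C\in\mathbb{R}^{p\times n}$. Then for all $(b,d)\in\{(Ax+s,Cx):x\in R,\ s\in\mathbb{R}^m_+\}$ and $u\in R$, $$\operatorname{dist}(u,P_A(b)\cap C^{-1}(d)\cap R)\le H(A,C\vert R)\cdot\operatorname{dist}\big((b-Au,d-Cu),\mathbb{R}^m_+\times\{0\}\big),$$ and this bound is tight: if $H(A,C\vert R)>0$ then there exist $(b,d)\in\{(Ax+s,Cx):x\in R,\ s\in\mathbb{R}^m_+\}$ and $u\in R$ such that $$\operatorname{dist}(u,P_A(b)\cap C^{-1}(d)\cap R)=H(A,C\vert R)\cdot\operatorname{dist}\big((b-Au,d-Cu),\mathbb{R}^m_+\times\{0\}\big)>0.$$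
   Context: $\mathbb{R}^n$ and $\mathbb{R}^m\times\mathbb{R}^p$ are each endowed with an arbitrary norm (not necessarily Euclidean), both denoted $\|\cdot\|$. For a nonempty closed set $S$, $\operatorname{dist}(u,S)=\min_{x\in S}\|u-x\|$. $P_A(b):=\{x\in\mathbb{R}^n:Ax\le b\}$, $C^{-1}(d):=\{x\in\mathbb{R}^n:Cx=d\}$, $C(K)=\{Cx:x\in K\}$, $[m]=\{1,\dots,m\}$. For $J\subseteq[m]$, $A_J$ is the submatrix of rows indexed by $J$ and $y_J$ the corresponding subvector of $y\in\mathbb{R}^m$. For a polyhedron $Q\subseteq\mathbb{R}^d$ and $u\in Q$, the tangent cone is $T_Q(u)=\{d\in\mathbb{R}^d:u+td\in Q\text{ for some }t>0\}$, and $\mathcal{T}(Q):=\{T_Q(u):u\in Q\}$, a finite collection. For $J\subseteq[m]$ and $K\subseteq\mathbb{R}^n$ let $[A,C;J](K):=\{(Ax+s,Cx): x\in K,\ s\in\mathbb{R}^m,\ s_J\ge0\}\subseteq\mathbb{R}^m\times\mathbb{R}^p$. Define $$\mathcal{S}(A,C\vert R):=\{(J,K):J\subseteq[m],\ K\in\mathcal{T}(R),\ [A,C;J](K)\text{ is a linear subspace}\},$$ $$H(A,C\vert R):=\max_{(J,K)\in\mathcal{S}(A,C\vert R)}\ \max_{(y,w)\in\mathbb{R}^m\times C(K),\ \|(y,w)\|\le1}\ \min_{x\in K,\ A_Jx\le y_J,\ Cx=w}\|x\|.$$ *)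

theory Defs
  imports "HOL-Analysis.Analysis"
begin

text \<open>
  The norms in play are arbitrary, so they are passed as functions; the norm of the
  type class is the Euclidean one (on \<^typ>\<open>real^'n\<close> and on products).
\<close>

definition is_norm :: "('a::real_vector \<Rightarrow> real) \<Rightarrow> bool" where
  "is_norm N \<longleftrightarrow>
     (\<forall>x. 0 \<le> N x) \<and> (\<forall>x. N x = 0 \<longleftrightarrow> x = 0) \<and>
     (\<forall>c x. N (c *\<^sub>R x) = \<bar>c\<bar> * N x) \<and> (\<forall>x y. N (x + y) \<le> N x + N y)"

text \<open>
  Minima and maxima are taken literally: \<^const>\<open>Least\<close> and \<^const>\<open>Greatest\<close> on the reals denote
  the attained minimum and maximum. Here they always exist: distances are taken to
  nonempty closed sets in finite dimension; see below for the constant.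
\<close>

definition set_dist :: "('a::real_vector \<Rightarrow> real) \<Rightarrow> 'a \<Rightarrow> 'a set \<Rightarrow> real" where
  "set_dist N u S = (LEAST r. r \<in> (\<lambda>x. N (u - x)) ` S)"

definition ineq_sols :: "real^'n^'m \<Rightarrow> real^'m \<Rightarrow> (real^'n) set" where
  "ineq_sols A b = {x. A *v x \<le> b}"

definition eq_sols :: "real^'n^'p \<Rightarrow> real^'p \<Rightarrow> (real^'n) set" where
  "eq_sols C d = {x. C *v x = d}"

definition feasible_rhs ::
  "real^'n^'m \<Rightarrow> real^'n^'p \<Rightarrow> (real^'n) set \<Rightarrow> ((real^'m) \<times> (real^'p)) set" where
  "feasible_rhs A C R = {(A *v x + s, C *v x) | x s. x \<in> R \<and> 0 \<le> s}"

definition tangent_cone :: "'a::real_vector set \<Rightarrow> 'a \<Rightarrow> 'a set" where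
  "tangent_cone Q u = {d. \<exists>t>0. u + t *\<^sub>R d \<in> Q}"

definition tangent_cones :: "'a::real_vector set \<Rightarrow> 'a set set" where
  "tangent_cones Q = tangent_cone Q ` Q"

definition cone_image ::
  "real^'n^'m \<Rightarrow> real^'n^'p \<Rightarrow> 'm set \<Rightarrow> (real^'n) set \<Rightarrow> ((real^'m) \<times> (real^'p)) set" where
  "cone_image A C J K = {(A *v x + s, C *v x) | x s. x \<in> K \<and> (\<forall>j\<in>J. 0 \<le> s $ j)}"

definition subspace_pairs ::
  "real^'n^'m \<Rightarrow> real^'n^'p \<Rightarrow> (real^'n) set \<Rightarrow> ('m set \<times> (real^'n) set) set" where
  "subspace_pairs A C R = {(J, K). K \<in> tangent_cones R \<and> subspace (cone_image A C J K)}"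

definition min_norm_sol ::
  "(real^'n \<Rightarrow> real) \<Rightarrow> real^'n^'m \<Rightarrow> real^'n^'p \<Rightarrow> 'm set \<Rightarrow> (real^'n) set
     \<Rightarrow> (real^'m) \<times> (real^'p) \<Rightarrow> real" where
  "min_norm_sol N A C J K = (\<lambda>(y, w).
     LEAST r. r \<in> N ` {x \<in> K. (\<forall>j\<in>J. (A *v x) $ j \<le> y $ j) \<and> C *v x = w})"

definition max_min_norm_sol ::
  "(real^'n \<Rightarrow> real) \<Rightarrow> ((real^'m) \<times> (real^'p) \<Rightarrow> real) \<Rightarrow> real^'n^'m \<Rightarrow> real^'n^'p
     \<Rightarrow> 'm set \<Rightarrow> (real^'n) set \<Rightarrow> real" where
  "max_min_norm_sol N M A C J K =
     (GREATEST r. r \<in> min_norm_sol N A C J K ` {(y, w). w \<in> (\<lambda>x. C *v x) ` K \<and> M (y, w) \<le> 1})"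

text \<open>
  A polyhedron has finitely many tangent cones, and for \<open>u\<close> in the relative interior of \<open>R\<close>
  the pair of \<open>{}\<close> and the tangent cone at \<open>u\<close> is admissible, so the outer maximum is over a
  finite nonempty set. If the cone image of \<open>(J, K)\<close> is a subspace, it contains all \<open>(y, w)\<close>
  with \<open>w\<close> in the (then linear) image of \<open>K\<close> under \<open>C\<close>. Hence the innermost minimum is over a
  nonempty closed set, and it is a sublinear, thus continuous, function of \<open>(y, w)\<close>, which
  ranges over a compact set.
\<close>

definition hoffman_const ::
  "(real^'n \<Rightarrow> real) \<Rightarrow> ((real^'m) \<times> (real^'p) \<Rightarrow> real) \<Rightarrow> real^'n^'m \<Rightarrow> real^'n^'p
     \<Rightarrow> (real^'n) set \<Rightarrow> real" where
  "hoffman_const N M A C R =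
     Max ((\<lambda>(J, K). max_min_norm_sol N M A C J K) ` subspace_pairs A C R)"

end

theory Submission
  imports Defs
begin

text \<open>
  Call a right-hand side \<open>(b, d)\<close> generic if it avoids finitely many affine sets, so that for every
  feasible \<open>x\<close> the active set of \<open>x\<close> and the tangent cone at \<open>x\<close> form an admissible pair. For generic
  \<open>(b, d)\<close> let \<open>x\<close> be feasible and nearest to \<open>u\<close>. The residual of \<open>u\<close> is the right-hand side of the
  local system at \<open>x\<close>, which has a solution \<open>v\<close> bounded by the Hoffman constant. As
  \<open>(x + \<epsilon> v + \<epsilon> u) / (1 + \<epsilon>)\<close> is feasible for small \<open>\<epsilon> > 0\<close>, the distance from \<open>u\<close> to \<open>x\<close> is
  at most the norm of \<open>v\<close>. Generic right-hand sides are dense among the feasible ones, and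
  compactness gives the general case. For tightness, take an extremal pair \<open>(J, K)\<close> with a
  maximizing right-hand side \<open>(y, w)\<close> and a point \<open>u\<close> with tangent cone \<open>K\<close>, and perturb
  \<open>(A u, C u)\<close> by a small multiple of \<open>(y, w)\<close>, with the inequalities outside \<open>J\<close> relaxed.
\<close>

section \<open>Arbitrary norms\<close>

lemma is_norm_zero: "is_norm N \<Longrightarrow> N 0 = 0"
  by (auto simp: is_norm_def)

lemma is_norm_scaleR: "is_norm N \<Longrightarrow> N (c *\<^sub>R x) = \<bar>c\<bar> * N x"
  by (auto simp: is_norm_def)

lemma is_norm_triangle: "is_norm N \<Longrightarrow> N (x + y) \<le> N x + N y"
  by (auto simp: is_norm_def)

lemma is_norm_nonneg: "is_norm N \<Longrightarrow> 0 \<le> N x"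
  by (auto simp: is_norm_def)

lemma is_norm_pos: "is_norm N \<Longrightarrow> x \<noteq> 0 \<Longrightarrow> 0 < N x"
  by (metis is_norm_def less_eq_real_def)

lemma is_norm_minus: "is_norm N \<Longrightarrow> N (- x) = N x"
  using is_norm_scaleR[of N "-1" x] by simp

lemma is_norm_minus_commute: "is_norm N \<Longrightarrow> N (x - y) = N (y - x)"
  using is_norm_minus[of N "x - y"] by simp

text \<open>A norm is convex by the triangle inequality and homogeneity, and a real-valued convex
  function on an open set of a finite-dimensional space is continuous.\<close>

lemma continuous_on_is_norm:
  fixes N :: "'a::euclidean_space \<Rightarrow> real"
  assumes "is_norm N"
  shows "continuous_on S N"
proof -
  have "convex_on UNIV N"
  proof (rule convex_onI)
    fix t :: real and x y :: 'a
    assume "0 < t" "t < 1"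
    then show "N ((1 - t) *\<^sub>R x + t *\<^sub>R y) \<le> (1 - t) * N x + t * N y"
      using is_norm_triangle[OF assms, of "(1 - t) *\<^sub>R x" "t *\<^sub>R y"]
      by (simp add: is_norm_scaleR[OF assms])
  qed simp
  then have "continuous_on UNIV N"
    by (intro convex_on_continuous) auto
  then show ?thesis
    using continuous_on_subset by blast
qed

text \<open>The constant is the minimum of \<open>N\<close> over the Euclidean unit sphere, attained
  by compactness and positive by definiteness; homogeneity carries the estimate to all
  vectors.\<close>

lemma is_norm_ge_norm:
  fixes N :: "'a::euclidean_space \<Rightarrow> real"
  assumes "is_norm N"
  obtains c where "c > 0" "\<And>x. c * norm x \<le> N x"
proof -
  have "\<exists>x\<in>sphere 0 1. \<forall>y\<in>sphere 0 1. N x \<le> N y"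
    by (rule continuous_attains_inf) (auto simp: continuous_on_is_norm[OF assms])
  then obtain e where e: "norm e = 1" and min: "\<And>y. norm y = 1 \<Longrightarrow> N e \<le> N y"
    by auto
  show ?thesis
  proof
    show "N e > 0"
      using e by (intro is_norm_pos[OF assms]) auto
    show "N e * norm x \<le> N x" for x
    proof (cases "x = 0")
      case False
      then have "N e \<le> N ((1 / norm x) *\<^sub>R x)"
        by (intro min) simp
      with False show ?thesis
        by (simp add: is_norm_scaleR[OF assms] field_simps)
    qed (simp add: is_norm_zero[OF assms])
  qed
qed

lemma continuous_on_is_norm_compose:
  fixes N :: "'a::euclidean_space \<Rightarrow> real"
  assumes "is_norm N" "continuous_on S f"
  shows "continuous_on S (\<lambda>x. N (f x))"
  using continuous_on_compose2[OF continuous_on_is_norm[OF assms(1)] assms(2)] by blast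

section \<open>Compact balls and attained distances\<close>

lemma compact_is_norm_cball:
  fixes N :: "'a::euclidean_space \<Rightarrow> real"
  assumes "is_norm N"
  shows "compact {x. N (u - x) \<le> r}"
proof -
  obtain c where c: "c > 0" "\<And>x. c * norm x \<le> N x"
    using is_norm_ge_norm[OF assms] by metis
  have "dist u x \<le> r / c" if "N (u - x) \<le> r" for x
    using that c(1) c(2)[of "u - x"] by (simp add: dist_norm field_simps)
  then have "{x. N (u - x) \<le> r} \<subseteq> cball u (r / c)"
    by auto
  moreover have "closed {x. N (u - x) \<le> r}"
    by (intro closed_Collect_le continuous_on_is_norm_compose[OF assms] continuous_intros)
  ultimately show ?thesis
    using bounded_subset[OF bounded_cball] compact_eq_bounded_closed by blast
qed

text \<open>Only points of \<open>S\<close> at most as far from \<open>u\<close> as some fixed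
  \<open>a\<close> in \<open>S\<close> matter, and these form a compact set. This is what makes the
  \<open>LEAST\<close> in \<open>set_dist\<close> a genuine minimum.\<close>

lemma set_dist_attained:
  fixes N :: "'a::euclidean_space \<Rightarrow> real"
  assumes N: "is_norm N" and S: "closed S" "S \<noteq> {}"
  obtains x where "x \<in> S" "set_dist N u S = N (u - x)" "\<And>y. y \<in> S \<Longrightarrow> N (u - x) \<le> N (u - y)"
proof -
  obtain a where a: "a \<in> S"
    using S by blast
  define B where "B = S \<inter> {x. N (u - x) \<le> N (u - a)}"
  have "compact B"
    unfolding B_def using S(1) compact_is_norm_cball[OF N] by (rule closed_Int_compact)
  moreover have "B \<noteq> {}"
    using a by (auto simp: B_def)
  moreover have "continuous_on B (\<lambda>x. N (u - x))"
    by (intro continuous_on_is_norm_compose[OF N] continuous_intros)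
  ultimately obtain x where x: "x \<in> B" and min: "\<And>y. y \<in> B \<Longrightarrow> N (u - x) \<le> N (u - y)"
    using continuous_attains_inf by metis
  have min': "N (u - x) \<le> N (u - y)" if "y \<in> S" for y
    using x min[of y] that by (cases "y \<in> B") (auto simp: B_def)
  have "set_dist N u S = N (u - x)"
    unfolding set_dist_def using x min' by (intro Least_equality) (auto simp: B_def)
  then show ?thesis
    using that x min' by (auto simp: B_def)
qed

lemma set_dist_le:
  fixes N :: "'a::euclidean_space \<Rightarrow> real"
  assumes "is_norm N" "closed S" "x \<in> S"
  shows "set_dist N u S \<le> N (u - x)"
  using set_dist_attained[OF assms(1,2), of u] assms(3) by force

section \<open>Tangent cones of polyhedra\<close>

lemma tangent_cone_segment:
  assumes "convex Q" "u \<in> Q" "d \<in> tangent_cone Q u"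
  obtains t where "t > 0" "\<And>s. 0 \<le> s \<Longrightarrow> s \<le> t \<Longrightarrow> u + s *\<^sub>R d \<in> Q"
proof -
  obtain t where t: "t > 0" "u + t *\<^sub>R d \<in> Q"
    using assms(3) by (auto simp: tangent_cone_def)
  have "u + s *\<^sub>R d \<in> Q" if "0 \<le> s" "s \<le> t" for s
  proof -
    have "(1 - s / t) *\<^sub>R u + (s / t) *\<^sub>R (u + t *\<^sub>R d) \<in> Q"
      using that t by (intro convexD[OF assms(1)]) (auto simp: assms(2) field_simps)
    moreover have "(1 - s / t) *\<^sub>R u + (s / t) *\<^sub>R (u + t *\<^sub>R d) = u + s *\<^sub>R d"
      using t(1) by (simp add: algebra_simps)
    ultimately show ?thesis
      by simp
  qed
  with t(1) that show ?thesis
    by blast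
qed

text \<open>Constraints active at \<open>u\<close> bound the admissible directions, while inactive
  ones have slack and survive a small step. One choice of \<open>F\<close>, \<open>a\<close> and
  \<open>b\<close> serves all \<open>u\<close>, so the cone depends only on the active subset of
  \<open>F\<close>.\<close>

lemma polyhedron_tangent_cone:
  fixes Q :: "'a::euclidean_space set"
  assumes "polyhedron Q"
  shows "\<exists>F (a :: 'a set \<Rightarrow> 'a) b. finite F \<and>
    (\<forall>u\<in>Q. tangent_cone Q u = {d. \<forall>h\<in>{h\<in>F. a h \<bullet> u = b h}. a h \<bullet> d \<le> 0})"
proof -
  obtain F where F: "finite F" "Q = \<Inter>F" "\<forall>h\<in>F. \<exists>a b. a \<noteq> 0 \<and> h = {x. a \<bullet> x \<le> b}"
    using assms by (auto simp: polyhedron_def)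
  then obtain a b where ab: "\<And>h. h \<in> F \<Longrightarrow> h = {x. a h \<bullet> x \<le> b h}"
    by metis
  then have Q: "x \<in> Q \<longleftrightarrow> (\<forall>h\<in>F. a h \<bullet> x \<le> b h)" for x
    unfolding F(2) by (metis (mono_tags, lifting) Inter_iff mem_Collect_eq)
  have "d \<in> tangent_cone Q u \<longleftrightarrow> (\<forall>h\<in>F. a h \<bullet> u = b h \<longrightarrow> a h \<bullet> d \<le> 0)" if u: "u \<in> Q" for u d
  proof
    assume "d \<in> tangent_cone Q u"
    then obtain t where t: "t > 0" "u + t *\<^sub>R d \<in> Q"
      by (auto simp: tangent_cone_def)
    then show "\<forall>h\<in>F. a h \<bullet> u = b h \<longrightarrow> a h \<bullet> d \<le> 0"
      unfolding Q by (fastforce simp: inner_add_right mult_le_0_iff)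
  next
    assume d: "\<forall>h\<in>F. a h \<bullet> u = b h \<longrightarrow> a h \<bullet> d \<le> 0"
    have "\<forall>\<^sub>F t in at_right 0. a h \<bullet> (u + t *\<^sub>R d) \<le> b h" if h: "h \<in> F" for h
    proof (cases "a h \<bullet> u = b h")
      case True
      show ?thesis
        using eventually_at_right_less[of "0::real"] by (rule eventually_mono)
          (use True d h in \<open>auto simp: inner_add_right mult_le_0_iff\<close>)
    next
      case False
      then have "a h \<bullet> u < b h"
        using Q u h by force
      moreover have "((\<lambda>t. a h \<bullet> (u + t *\<^sub>R d)) \<longlongrightarrow> a h \<bullet> (u + 0 *\<^sub>R d)) (at_right 0)"
        by (intro tendsto_intros)
      ultimately show ?thesis
        using order_tendstoD(2) eventually_mono less_imp_le
        by (smt (verit, best) add.right_neutral scaleR_zero_left)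
    qed
    \<comment> \<open>Finiteness of \<open>F\<close> gives one step length that suits all
      constraints at once.\<close>
    then have "\<forall>\<^sub>F t in at_right (0::real). \<forall>h\<in>F. a h \<bullet> (u + t *\<^sub>R d) \<le> b h"
      using F(1) by (simp add: eventually_ball_finite_distrib)
    then have "\<forall>\<^sub>F t in at_right (0::real). t > 0 \<and> u + t *\<^sub>R d \<in> Q"
      using eventually_at_right_less[of "0::real"] unfolding Q by eventually_elim auto
    then show "d \<in> tangent_cone Q u"
      unfolding tangent_cone_def using eventually_happens'[OF trivial_limit_at_right_real] by auto
  qed
  then have "tangent_cone Q u = {d. \<forall>h\<in>{h\<in>F. a h \<bullet> u = b h}. a h \<bullet> d \<le> 0}" if "u \<in> Q" for u
    using that by blast
  with F(1) show ?thesis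
    by blast
qed

lemma convex_cone_tangent_cone:
  fixes Q :: "'a::euclidean_space set"
  assumes "polyhedron Q" "u \<in> Q"
  shows "convex_cone (tangent_cone Q u)"
proof -
  obtain F and a :: "'a set \<Rightarrow> 'a" and b where F: "finite F"
    "\<forall>u\<in>Q. tangent_cone Q u = {d. \<forall>h\<in>{h\<in>F. a h \<bullet> u = b h}. a h \<bullet> d \<le> 0}"
    using polyhedron_tangent_cone[OF assms(1)] by blast
  show ?thesis
    unfolding F(2)[rule_format, OF assms(2)] convex_cone_iff by (auto simp: inner_add_right add_nonpos_nonpos mult_nonneg_nonpos)
qed

lemma closed_tangent_cone:
  fixes Q :: "'a::euclidean_space set"
  assumes "polyhedron Q" "u \<in> Q"
  shows "closed (tangent_cone Q u)"
proof -
  obtain F and a :: "'a set \<Rightarrow> 'a" and b where F: "finite F"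
    "\<forall>u\<in>Q. tangent_cone Q u = {d. \<forall>h\<in>{h\<in>F. a h \<bullet> u = b h}. a h \<bullet> d \<le> 0}"
    using polyhedron_tangent_cone[OF assms(1)] by blast
  have "tangent_cone Q u = (\<Inter>h\<in>{h\<in>F. a h \<bullet> u = b h}. {d. a h \<bullet> d \<le> 0})"
    unfolding F(2)[rule_format, OF assms(2)] by auto
  then show ?thesis
    by (simp add: closed_INT closed_halfspace_le)
qed

text \<open>Each cone is determined by a subset of the finite set \<open>F\<close>, namely the
  constraints active at its base point.\<close>

lemma finite_tangent_cones:
  fixes Q :: "'a::euclidean_space set"
  assumes "polyhedron Q"
  shows "finite (tangent_cones Q)"
proof -
  obtain F and a :: "'a set \<Rightarrow> 'a" and b where F: "finite F"
    "\<forall>u\<in>Q. tangent_cone Q u = {d. \<forall>h\<in>{h\<in>F. a h \<bullet> u = b h}. a h \<bullet> d \<le> 0}"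
    using polyhedron_tangent_cone[OF assms] by blast
  have "tangent_cones Q \<subseteq> (\<lambda>G. {d. \<forall>h\<in>G. a h \<bullet> d \<le> 0}) ` Pow F"
    unfolding tangent_cones_def using F(2) by blast
  then show ?thesis
    using F(1) finite_subset by blast
qed

lemma diff_in_tangent_cone: "x \<in> Q \<Longrightarrow> x - u \<in> tangent_cone Q u"
  unfolding tangent_cone_def by (auto intro: exI[of _ 1])

section \<open>Avoiding finitely many affine sets\<close>

lemma affine_line_two_points:
  assumes "affine V" "z + s *\<^sub>R h \<in> V" "z + t *\<^sub>R h \<in> V" "s \<noteq> t"
  shows "z + r *\<^sub>R h \<in> V"
proof -
  \<comment> \<open>The affine coordinate of the parameter \<open>r\<close> relative to
    \<open>s\<close> and \<open>t\<close>.\<close>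
  define q where "q = (r - s) / (t - s)"
  have "(1 - q) *\<^sub>R (z + s *\<^sub>R h) + q *\<^sub>R (z + t *\<^sub>R h) \<in> V"
    using assms by (simp add: affine_alt)
  moreover have "(1 - q) *\<^sub>R (z + s *\<^sub>R h) + q *\<^sub>R (z + t *\<^sub>R h) = z + (s + q * (t - s)) *\<^sub>R h"
    by (simp add: algebra_simps)
  moreover have "s + q * (t - s) = r"
    using assms(4) by (simp add: q_def)
  ultimately show ?thesis
    by simp
qed

text \<open>An affine set that meets a line in two points contains the line, so a line with one
  point outside \<open>V\<close> meets \<open>V\<close> at most once.\<close>

lemma finite_affine_line:
  fixes z h :: "'a::real_vector"
  assumes "affine V" "z + r *\<^sub>R h \<notin> V"
  shows "finite {t. z + t *\<^sub>R h \<in> V}"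
proof (cases "{t. z + t *\<^sub>R h \<in> V} = {}")
  case False
  then obtain s where "z + s *\<^sub>R h \<in> V"
    by auto
  then have "{t. z + t *\<^sub>R h \<in> V} \<subseteq> {s}"
    using affine_line_two_points[OF assms(1)] assms(2) by blast
  then show ?thesis
    using finite_subset by blast
qed (metis finite.emptyI)

text \<open>Induction on the number of sets: join a point \<open>z\<close> outside the earlier sets
  to a point \<open>a\<close> outside the new one. The line through them lies in none of the sets,
  so only finitely many parameters of the segment are bad.\<close>

lemma convex_not_subset_Union_affine:
  fixes D :: "'a::real_vector set"
  assumes "finite \<V>" "convex D" "D \<noteq> {}" "\<And>V. V \<in> \<V> \<Longrightarrow> affine V \<and> \<not> D \<subseteq> V"
  shows "\<not> D \<subseteq> \<Union>\<V>"
  using assms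
proof (induction \<V> rule: finite_induct)
  case (insert W \<V>)
  have "\<not> D \<subseteq> \<Union>\<V>" "\<not> D \<subseteq> W"
    using insert by auto
  then obtain z a where z: "z \<in> D" "z \<notin> \<Union>\<V>" and a: "a \<in> D" "a \<notin> W"
    by blast
  have "finite {t. z + t *\<^sub>R (a - z) \<in> V}" if "V \<in> insert W \<V>" for V
  proof (cases "V = W")
    case True
    then show ?thesis
      using finite_affine_line[of W z 1 "a - z"] insert.prems(3) a by auto
  next
    case False
    then show ?thesis
      using finite_affine_line[of V z 0 "a - z"] insert.prems(3)[OF that] that z by auto
  qed
  then have fin: "finite (\<Union>V\<in>insert W \<V>. {t. z + t *\<^sub>R (a - z) \<in> V})"
    using insert.hyps(1) by blast
  have "\<not> {0..1} \<subseteq> (\<Union>V\<in>insert W \<V>. {t. z + t *\<^sub>R (a - z) \<in> V})"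
    using infinite_Icc[OF zero_less_one] finite_subset[OF _ fin] by blast
  then obtain t where "t \<in> {0..1}" "\<forall>V\<in>insert W \<V>. z + t *\<^sub>R (a - z) \<notin> V"
    by blast
  then have t: "0 \<le> t" "t \<le> 1" "z + t *\<^sub>R (a - z) \<notin> \<Union>(insert W \<V>)"
    by auto
  moreover have "z + t *\<^sub>R (a - z) \<in> D"
    using convexD_alt[OF insert.prems(1) z(1) a(1) t(1,2)] by (simp add: algebra_simps)
  ultimately show ?case
    by blast
qed simp

text \<open>Move from \<open>z\<close> towards one point \<open>a\<close> of \<open>D\<close>
  outside all the sets. Finitely many parameters are bad, so arbitrarily small good ones
  remain.\<close>

lemma convex_approx_avoiding_affine:
  fixes D :: "'a::real_normed_vector set"
  assumes \<V>: "finite \<V>" "\<And>V. V \<in> \<V> \<Longrightarrow> affine V \<and> \<not> D \<subseteq> V" and D: "convex D" "z \<in> D"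
  obtains \<zeta> where "\<And>k::nat. \<zeta> k \<in> D - \<Union>\<V>" "\<zeta> \<longlonglongrightarrow> z"
proof -
  obtain a where a: "a \<in> D" "a \<notin> \<Union>\<V>"
    using convex_not_subset_Union_affine[OF \<V>(1) D(1) _ \<V>(2)] D(2) by blast
  have "finite {t. z + t *\<^sub>R (a - z) \<in> V}" if "V \<in> \<V>" for V
    using finite_affine_line[of V z 1 "a - z"] \<V>(2)[OF that] that a by auto
  then have fin: "finite (\<Union>V\<in>\<V>. {t. z + t *\<^sub>R (a - z) \<in> V})"
    using \<V>(1) by blast
  have "\<exists>t. 0 < t \<and> t < inverse (real (Suc k)) \<and> z + t *\<^sub>R (a - z) \<notin> \<Union>\<V>" for k
  proof -
    have pos: "0 < inverse (real (Suc k))"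
      by simp
    have "\<not> {0<..<inverse (real (Suc k))} \<subseteq> (\<Union>V\<in>\<V>. {t. z + t *\<^sub>R (a - z) \<in> V})"
      using infinite_Ioo[OF pos] finite_subset[OF _ fin] by blast
    then obtain t where "t \<in> {0<..<inverse (real (Suc k))}" "\<forall>V\<in>\<V>. z + t *\<^sub>R (a - z) \<notin> V"
      by blast
    then show ?thesis
      by auto
  qed
  then obtain t where t: "\<And>k. 0 < t k" "\<And>k. t k < inverse (real (Suc k))"
    "\<And>k. z + t k *\<^sub>R (a - z) \<notin> \<Union>\<V>"
    by metis
  have "t \<longlonglongrightarrow> 0"
    by (rule real_tendsto_sandwich[OF _ _ tendsto_const LIMSEQ_inverse_real_of_nat])
      (use less_imp_le[OF t(1)] less_imp_le[OF t(2)] in \<open>auto intro!: always_eventually\<close>)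
  then have "(\<lambda>k. z + t k *\<^sub>R (a - z)) \<longlonglongrightarrow> z + 0 *\<^sub>R (a - z)"
    by (intro tendsto_intros)
  moreover have "z + t k *\<^sub>R (a - z) \<in> D" for k
  proof -
    have "t k \<le> 1"
      using t(2)[of k] by (smt (verit) inverse_le_1_iff of_nat_Suc of_nat_0_le_iff)
    then show ?thesis
      using convexD_alt[OF D(1) D(2) a(1), of "t k"] t(1)[of k] by (simp add: algebra_simps)
  qed
  ultimately show ?thesis
    using that[of "\<lambda>k. z + t k *\<^sub>R (a - z)"] t(3) by auto
qed

section \<open>The Hoffman constant\<close>

definition local_sols ::
  "real^'n^'m \<Rightarrow> real^'n^'p \<Rightarrow> 'm set \<Rightarrow> (real^'n) set \<Rightarrow> (real^'m) \<times> (real^'p) \<Rightarrow> (real^'n) set" where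
  "local_sols A C J K = (\<lambda>(y, w). {x \<in> K. (\<forall>j\<in>J. (A *v x) $ j \<le> y $ j) \<and> C *v x = w})"

lemma closed_local_sols:
  assumes "closed K"
  shows "closed (local_sols A C J K z)"
proof -
  obtain y w where z: "z = (y, w)"
    by force
  have "local_sols A C J K z = K \<inter> (\<Inter>j\<in>J. {x. (A *v x) $ j \<le> y $ j}) \<inter> {x. C *v x = w}"
    by (auto simp: local_sols_def z)
  moreover have "closed {x. (A *v x) $ j \<le> y $ j}" for j
    by (intro closed_Collect_le continuous_intros)
  moreover have "closed {x. C *v x = w}"
    by (intro closed_Collect_eq continuous_intros)
  ultimately show ?thesis
    using assms by (auto intro!: closed_Int closed_INT)
qed

lemma min_norm_sol_eq_set_dist:
  assumes "is_norm N"
  shows "min_norm_sol N A C J K z = set_dist N 0 (local_sols A C J K z)"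
  by (cases z) (simp add: min_norm_sol_def set_dist_def local_sols_def is_norm_minus[OF assms])

lemma mem_cone_image_iff: "z \<in> cone_image A C J K \<longleftrightarrow> local_sols A C J K z \<noteq> {}"
proof (cases z)
  case (Pair y w)
  have "z \<in> cone_image A C J K" if "x \<in> local_sols A C J K z" for x
    unfolding cone_image_def Pair
    by (rule CollectI, rule exI[of _ x], rule exI[of _ "y - A *v x"])
      (use that in \<open>auto simp: local_sols_def Pair\<close>)
  then show ?thesis
    by (auto simp: cone_image_def local_sols_def Pair)
qed

lemma cone_image_convex_cone:
  assumes "convex_cone K"
  shows "convex_cone (cone_image A C J K)"
  unfolding convex_cone_iff
proof (intro conjI ballI allI impI)
  show "0 \<in> cone_image A C J K"
    unfolding cone_image_def zero_prod_def
    by (rule CollectI, rule exI[of _ 0], rule exI[of _ 0]) (use convex_cone_contains_0[OF assms] in auto)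
next
  fix z z' assume "z \<in> cone_image A C J K" "z' \<in> cone_image A C J K"
  then obtain x s x' s' where "z = (A *v x + s, C *v x)" "x \<in> K" "\<forall>j\<in>J. 0 \<le> s $ j"
    "z' = (A *v x' + s', C *v x')" "x' \<in> K" "\<forall>j\<in>J. 0 \<le> s' $ j"
    by (auto simp: cone_image_def)
  then show "z + z' \<in> cone_image A C J K"
    unfolding cone_image_def
    by (intro CollectI exI[of _ "x + x'"] exI[of _ "s + s'"])
      (use convex_cone_add[OF assms] in \<open>auto simp: matrix_vector_right_distrib\<close>)
next
  fix z and c :: real assume "z \<in> cone_image A C J K" "0 \<le> c"
  then obtain x s where "z = (A *v x + s, C *v x)" "x \<in> K" "\<forall>j\<in>J. 0 \<le> s $ j"
    by (auto simp: cone_image_def)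
  then show "c *\<^sub>R z \<in> cone_image A C J K"
    unfolding cone_image_def
    by (intro CollectI exI[of _ "c *\<^sub>R x"] exI[of _ "c *\<^sub>R s"])
      (use convex_cone_scaleR[OF assms] \<open>0 \<le> c\<close> in
        \<open>auto simp: matrix_vector_mult_scaleR scaleR_add_right\<close>)
qed

text \<open>The image always contains \<open>(s, 0)\<close> for \<open>s \<ge> 0\<close>. A subspace
  is closed under differences and therefore contains \<open>(s, 0)\<close> for every
  \<open>s\<close>, so the first component is unrestricted.\<close>

lemma cone_image_subspace_iff:
  assumes "subspace (cone_image A C J K)" "0 \<in> K"
  shows "(y, w) \<in> cone_image A C J K \<longleftrightarrow> w \<in> (\<lambda>x. C *v x) ` K"
proof
  assume "w \<in> (\<lambda>x. C *v x) ` K"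
  then obtain x where x: "x \<in> K" "w = C *v x"
    by auto
  have nonneg: "(s, 0) \<in> cone_image A C J K" if "0 \<le> s" for s
    unfolding cone_image_def
    by (intro CollectI exI[of _ 0] exI[of _ s]) (use assms(2) that in \<open>auto simp: less_eq_vec_def\<close>)
  define s where "s = y - A *v x"
  \<comment> \<open>The positive part of \<open>s\<close> minus its negative part.\<close>
  have "(\<chi> j. max 0 (s $ j), 0) - (\<chi> j. max 0 (- s $ j), 0) \<in> cone_image A C J K"
    by (intro subspace_diff[OF assms(1)] nonneg) (auto simp: less_eq_vec_def)
  moreover have "(\<chi> j. max 0 (s $ j)) - (\<chi> j. max 0 (- s $ j)) = s"
    by (simp add: vec_eq_iff max_def)
  moreover have "(A *v x, C *v x) \<in> cone_image A C J K"
    unfolding cone_image_def by (intro CollectI exI[of _ x] exI[of _ 0]) (use x in auto)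
  ultimately have "(A *v x, C *v x) + (s, 0) \<in> cone_image A C J K"
    using subspace_add[OF assms(1)] by fastforce
  then show "(y, w) \<in> cone_image A C J K"
    by (simp add: s_def x)
qed (auto simp: cone_image_def)

lemma min_norm_sol_attained:
  assumes "is_norm N" "closed K" "z \<in> cone_image A C J K"
  obtains x where "x \<in> local_sols A C J K z" "N x = min_norm_sol N A C J K z"
proof -
  obtain x where "x \<in> local_sols A C J K z" "set_dist N 0 (local_sols A C J K z) = N (0 - x)"
    using set_dist_attained[OF assms(1) closed_local_sols[OF assms(2)]] assms(3) mem_cone_image_iff
    by metis
  then show ?thesis
    using that by (simp add: min_norm_sol_eq_set_dist[OF assms(1)] is_norm_minus[OF assms(1)])
qed

lemma min_norm_sol_le:
  assumes "is_norm N" "closed K" "x \<in> local_sols A C J K z"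
  shows "min_norm_sol N A C J K z \<le> N x"
  using set_dist_le[OF assms(1) closed_local_sols[OF assms(2)] assms(3), of 0]
  by (simp add: min_norm_sol_eq_set_dist[OF assms(1)] is_norm_minus[OF assms(1)])

lemma local_sols_add:
  assumes "convex_cone K" "x \<in> local_sols A C J K z" "x' \<in> local_sols A C J K z'"
  shows "x + x' \<in> local_sols A C J K (z + z')"
proof -
  obtain y w y' w' where "z = (y, w)" "z' = (y', w')"
    by (meson surj_pair)
  then show ?thesis
    using assms(2,3) convex_cone_add[OF assms(1), of x x']
    by (simp add: local_sols_def matrix_vector_right_distrib add_mono)
qed

lemma local_sols_scaleR:
  assumes "convex_cone K" "x \<in> local_sols A C J K z" "0 \<le> c"
  shows "c *\<^sub>R x \<in> local_sols A C J K (c *\<^sub>R z)"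
proof -
  obtain y w where "z = (y, w)"
    by force
  then show ?thesis
    using assms(2,3) convex_cone_scaleR[OF assms(1,3), of x]
    by (simp add: local_sols_def matrix_vector_mult_scaleR mult_left_mono)
qed

text \<open>Solutions can be added and scaled, which makes the minimal norm convex on the subspace.
  Composing with a linear projection \<open>P\<close> onto the subspace yields a convex, hence
  continuous, function on the whole space that agrees with the original on the subspace.\<close>

lemma continuous_on_min_norm_sol:
  fixes A :: "real^'n^'m" and C :: "real^'n^'p"
  assumes N: "is_norm N" and K: "closed K" "convex_cone K" and sub: "subspace (cone_image A C J K)"
  shows "continuous_on (cone_image A C J K) (min_norm_sol N A C J K)"
proof -
  define L where "L = cone_image A C J K"
  define f where "f = min_norm_sol N A C J K"
  \<comment> \<open>A linear left inverse of the inclusion of \<open>L\<close> with range in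
    \<open>L\<close> is a projection onto \<open>L\<close>.\<close>
  have "\<exists>P. range P \<subseteq> L \<and> linear P \<and> (\<forall>v\<in>L. P (id v) = v)"
    by (rule real_vector.linear_exists_left_inverse_on) (use sub in \<open>auto simp: L_def intro!: linearI\<close>)
  then obtain P where P: "range P \<subseteq> L" "linear P" "\<And>v. v \<in> L \<Longrightarrow> P v = v"
    by auto
  have "convex_on UNIV (\<lambda>z. f (P z))"
  proof (rule convex_onI)
    fix t :: real and z z' :: "(real^'m) \<times> (real^'p)"
    assume t: "0 < t" "t < 1"
    have "P z \<in> L" "P z' \<in> L"
      using P(1) by auto
    obtain x where x: "x \<in> local_sols A C J K (P z)" "N x = f (P z)"
      unfolding f_def by (rule min_norm_sol_attained[OF N K(1)]) (use P(1) L_def in auto)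
    obtain x' where x': "x' \<in> local_sols A C J K (P z')" "N x' = f (P z')"
      unfolding f_def by (rule min_norm_sol_attained[OF N K(1)]) (use P(1) L_def in auto)
    have "f (P ((1 - t) *\<^sub>R z + t *\<^sub>R z')) = f ((1 - t) *\<^sub>R P z + t *\<^sub>R P z')"
      using P(2) by (simp add: linear_add linear_scale)
    also have "\<dots> \<le> N ((1 - t) *\<^sub>R x + t *\<^sub>R x')"
      unfolding f_def using t x(1) x'(1)
      by (intro min_norm_sol_le[OF N K(1)] local_sols_add local_sols_scaleR K) auto
    also have "\<dots> \<le> (1 - t) * N x + t * N x'"
      using is_norm_triangle[OF N, of "(1 - t) *\<^sub>R x" "t *\<^sub>R x'"] t
      by (simp add: is_norm_scaleR[OF N])
    finally show "f (P ((1 - t) *\<^sub>R z + t *\<^sub>R z')) \<le> (1 - t) * f (P z) + t * f (P z')"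
      by (simp add: x x')
  qed simp
  then have "continuous_on UNIV (\<lambda>z. f (P z))"
    by (intro convex_on_continuous) auto
  then have "continuous_on L (\<lambda>z. f (P z))"
    using continuous_on_subset by blast
  then show ?thesis
    using P(3) by (simp add: L_def f_def cong: continuous_on_cong)
qed

section \<open>The maxima in the Hoffman constant\<close>

lemma max_min_norm_sol_attained:
  fixes A :: "real^'n^'m" and C :: "real^'n^'p"
  assumes N: "is_norm N" and M: "is_norm M"
    and K: "closed K" "convex_cone K" and sub: "subspace (cone_image A C J K)"
  obtains z where "z \<in> cone_image A C J K" "M z \<le> 1"
    "max_min_norm_sol N M A C J K = min_norm_sol N A C J K z"
    "\<And>z'. z' \<in> cone_image A C J K \<Longrightarrow> M z' \<le> 1
       \<Longrightarrow> min_norm_sol N A C J K z' \<le> max_min_norm_sol N M A C J K"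
proof -
  define B where "B = cone_image A C J K \<inter> {z. M z \<le> 1}"
  have "{z. M z \<le> 1} = {z. M (0 - z) \<le> 1}"
    by (simp add: is_norm_minus[OF M])
  then have "compact B"
    unfolding B_def using compact_is_norm_cball[OF M, of 0 1] closed_subspace[OF sub]
    by (metis closed_Int_compact)
  moreover have "0 \<in> B"
    using subspace_0[OF sub] is_norm_zero[OF M] by (simp add: B_def)
  moreover have "continuous_on B (min_norm_sol N A C J K)"
    using continuous_on_min_norm_sol[OF N K sub] continuous_on_subset B_def by blast
  ultimately obtain z where z: "z \<in> B"
    and max: "\<And>z'. z' \<in> B \<Longrightarrow> min_norm_sol N A C J K z' \<le> min_norm_sol N A C J K z"
    using continuous_attains_sup[of B "min_norm_sol N A C J K"] by blast
  \<comment> \<open>Because the cone image is a subspace, the condition on \<open>w\<close> alone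
    already describes membership in it; thus the \<open>GREATEST\<close> ranges over the compact set
    \<open>B\<close>.\<close>
  have "{(y, w). w \<in> (\<lambda>x. C *v x) ` K \<and> M (y, w) \<le> 1} = B"
    unfolding B_def
    using cone_image_subspace_iff[OF sub convex_cone_contains_0[OF K(2)]] by blast
  then have "max_min_norm_sol N M A C J K = min_norm_sol N A C J K z"
    unfolding max_min_norm_sol_def using z max by (intro Greatest_equality) auto
  then show ?thesis
    using that[of z] z max by (simp add: B_def)
qed

text \<open>Normalize \<open>z\<close> to unit \<open>M\<close>-norm and scale a minimal solution
  back; the zero right-hand side, which cannot be normalized, has the solution 0.\<close>

lemma min_norm_sol_le_max:
  assumes N: "is_norm N" and M: "is_norm M"
    and K: "closed K" "convex_cone K" and sub: "subspace (cone_image A C J K)"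
    and z: "z \<in> cone_image A C J K"
  shows "min_norm_sol N A C J K z \<le> max_min_norm_sol N M A C J K * M z"
proof (cases "z = 0")
  case True
  have "0 \<in> local_sols A C J K 0"
    using convex_cone_contains_0[OF K(2)] by (auto simp: local_sols_def zero_prod_def)
  from min_norm_sol_le[OF N K(1) this] True show ?thesis
    by (simp add: is_norm_zero N M)
next
  case False
  then have pos: "M z > 0"
    by (rule is_norm_pos[OF M])
  define z' where "z' = (1 / M z) *\<^sub>R z"
  have z': "z' \<in> cone_image A C J K"
    unfolding z'_def using sub z by (rule subspace_scale)
  have "M z' \<le> 1"
    using pos by (simp add: z'_def is_norm_scaleR[OF M])
  then have le: "min_norm_sol N A C J K z' \<le> max_min_norm_sol N M A C J K"
    using max_min_norm_sol_attained[OF N M K sub] z' by metis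
  obtain x where x: "x \<in> local_sols A C J K z'" "N x = min_norm_sol N A C J K z'"
    using min_norm_sol_attained[OF N K(1) z'] .
  have "M z *\<^sub>R x \<in> local_sols A C J K (M z *\<^sub>R z')"
    using pos by (intro local_sols_scaleR K x) auto
  moreover have "M z *\<^sub>R z' = z"
    using pos by (simp add: z'_def)
  ultimately have "min_norm_sol N A C J K z \<le> N (M z *\<^sub>R x)"
    using min_norm_sol_le[OF N K(1)] by metis
  also have "\<dots> = M z * min_norm_sol N A C J K z'"
    using pos by (simp add: is_norm_scaleR[OF N] x)
  also have "\<dots> \<le> max_min_norm_sol N M A C J K * M z"
    using le pos by (simp add: mult.commute)
  finally show ?thesis .
qed

lemma finite_subspace_pairs:
  fixes A :: "real^'n^'m"
  assumes "polyhedron R"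
  shows "finite (subspace_pairs A C R)"
proof -
  have "subspace_pairs A C R \<subseteq> UNIV \<times> tangent_cones R"
    by (auto simp: subspace_pairs_def)
  then show ?thesis
    by (rule finite_subset) (simp add: finite_tangent_cones[OF assms])
qed

lemma subspace_pairs_closed: "polyhedron R \<Longrightarrow> (J, K) \<in> subspace_pairs A C R \<Longrightarrow> closed K"
  using closed_tangent_cone by (auto simp: subspace_pairs_def tangent_cones_def)

lemma subspace_pairs_convex_cone:
  "polyhedron R \<Longrightarrow> (J, K) \<in> subspace_pairs A C R \<Longrightarrow> convex_cone K"
  using convex_cone_tangent_cone by (auto simp: subspace_pairs_def tangent_cones_def)

text \<open>This is the only form in which the size of the constant enters the error bound: every
  solvable right-hand side of an admissible pair has a solution of controlled norm.\<close>

lemma local_sol_le_hoffman_const: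
  fixes A :: "real^'n^'m"
  assumes N: "is_norm N" and M: "is_norm M" and R: "polyhedron R"
    and JK: "(J, K) \<in> subspace_pairs A C R" and z: "z \<in> cone_image A C J K"
  obtains v where "v \<in> local_sols A C J K z" "N v \<le> hoffman_const N M A C R * M z"
proof -
  note K = subspace_pairs_closed[OF R JK] subspace_pairs_convex_cone[OF R JK]
  have sub: "subspace (cone_image A C J K)"
    using JK by (simp add: subspace_pairs_def)
  obtain v where v: "v \<in> local_sols A C J K z" "N v = min_norm_sol N A C J K z"
    using min_norm_sol_attained[OF N K(1) z] .
  have "max_min_norm_sol N M A C J K \<le> hoffman_const N M A C R"
    unfolding hoffman_const_def
    by (rule Max_ge) (use JK finite_subspace_pairs[OF R] in \<open>auto intro: rev_image_eqI\<close>)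
  then have "N v \<le> hoffman_const N M A C R * M z"
    using min_norm_sol_le_max[OF N M K sub z] is_norm_nonneg[OF M, of z] v(2)
    by (metis mult_right_mono order_trans)
  with v(1) that show ?thesis
    by blast
qed

section \<open>Generic right-hand sides\<close>

text \<open>The feasible right-hand sides having a feasible point with tangent cone \<open>K\<close>
  at which exactly the inequalities in \<open>J\<close> are tight.\<close>

definition active_values ::
  "real^'n^'m \<Rightarrow> real^'n^'p \<Rightarrow> (real^'n) set \<Rightarrow> 'm set \<Rightarrow> (real^'n) set \<Rightarrow> ((real^'m) \<times> (real^'p)) set" where
  "active_values A C R J K =
     {(A *v x + s, C *v x) | x s. x \<in> R \<and> 0 \<le> s \<and> tangent_cone R x = K \<and> {j. s $ j = 0} = J}"

lemma mem_active_values: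
  assumes "x \<in> ineq_sols A b \<inter> eq_sols C d \<inter> R"
  shows "(b, d) \<in> active_values A C R {j. (A *v x) $ j = b $ j} (tangent_cone R x)"
  unfolding active_values_def
  by (rule CollectI, rule exI[of _ x], rule exI[of _ "b - A *v x"])
    (use assms in \<open>auto simp: ineq_sols_def eq_sols_def less_eq_vec_def\<close>)

lemma mem_feasible_rhs_iff:
  "(b, d) \<in> feasible_rhs A C R \<longleftrightarrow> ineq_sols A b \<inter> eq_sols C d \<inter> R \<noteq> {}"
proof -
  have "(b, d) \<in> feasible_rhs A C R" if "x \<in> ineq_sols A b \<inter> eq_sols C d \<inter> R" for x
    unfolding feasible_rhs_def
    by (rule CollectI, rule exI[of _ x], rule exI[of _ "b - A *v x"])
      (use that in \<open>auto simp: ineq_sols_def eq_sols_def less_eq_vec_def\<close>)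
  moreover have "\<exists>x. x \<in> ineq_sols A b \<inter> eq_sols C d \<inter> R" if bd: "(b, d) \<in> feasible_rhs A C R"
  proof -
    obtain x s where "b = A *v x + s" "d = C *v x" "x \<in> R" "0 \<le> s"
      using bd by (auto simp: feasible_rhs_def)
    then show ?thesis
      by (intro exI[of _ x]) (auto simp: ineq_sols_def eq_sols_def less_eq_vec_def)
  qed
  ultimately show ?thesis
    by blast
qed

lemma convex_feasible_rhs:
  assumes "convex R"
  shows "convex (feasible_rhs A C R)"
proof (rule convexI)
  fix z z' and u v :: real
  assume "z \<in> feasible_rhs A C R" "z' \<in> feasible_rhs A C R" and uv: "0 \<le> u" "0 \<le> v" "u + v = 1"
  then obtain x s x' s' where "z = (A *v x + s, C *v x)" "x \<in> R" "0 \<le> s"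
    "z' = (A *v x' + s', C *v x')" "x' \<in> R" "0 \<le> s'"
    by (auto simp: feasible_rhs_def)
  then show "u *\<^sub>R z + v *\<^sub>R z' \<in> feasible_rhs A C R"
    unfolding feasible_rhs_def
    by (intro CollectI exI[of _ "u *\<^sub>R x + v *\<^sub>R x'"] exI[of _ "u *\<^sub>R s + v *\<^sub>R s'"])
      (use uv convexD[OF assms] in
        \<open>auto simp: matrix_vector_mult_scaleR matrix_vector_right_distrib scaleR_add_right less_eq_vec_def\<close>)
qed

text \<open>
  Two points with the same active set and tangent cone differ by a direction of the cone image
  whose negative is also a direction, so if such points span all right-hand sides affinely,
  every direction is reversible.
\<close>

lemma subspace_cone_image_if_spanning:
  fixes A :: "real^'n^'m" and C :: "real^'n^'p"
  assumes R: "polyhedron R" "R \<noteq> {}"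
    and span: "feasible_rhs A C R \<subseteq> affine hull active_values A C R J K"
  shows "subspace (cone_image A C J K)"
proof -
  obtain u where "u \<in> R"
    using R by auto
  then have "(A *v u + 0, C *v u) \<in> feasible_rhs A C R"
    unfolding feasible_rhs_def by blast
  then have "active_values A C R J K \<noteq> {}"
    using span by auto
  then obtain x0 and s0 :: "real^'m" where x0: "x0 \<in> R" "tangent_cone R x0 = K" and s0: "0 \<le> s0" "{j. s0 $ j = 0} = J"
    unfolding active_values_def by blast
  define z0 where "z0 = (A *v x0 + s0, C *v x0)"
  define L where "L = cone_image A C J K"
  \<comment> \<open>The lineality space of the cone \<open>L\<close>; the aim is to show that it is
    all of \<open>L\<close>.\<close>
  define S where "S = {v \<in> L. - v \<in> L}"
  have K: "convex_cone K"
    using convex_cone_tangent_cone[OF R(1) x0(1)] x0(2) by simp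
  then have L: "convex_cone L"
    unfolding L_def by (rule cone_image_convex_cone)
  have "subspace S"
    unfolding subspace_def S_def
  proof (intro conjI ballI allI CollectI)
    fix c :: real and v assume v: "v \<in> {v \<in> L. - v \<in> L}"
    have "\<bar>c\<bar> *\<^sub>R v \<in> L \<and> \<bar>c\<bar> *\<^sub>R (- v) \<in> L"
      using v convex_cone_scaleR[OF L abs_ge_zero[of c]] by blast
    then show "c *\<^sub>R v \<in> L" "- (c *\<^sub>R v) \<in> L"
      by (cases "c \<ge> 0"; simp)+
  next
    fix v w assume "v \<in> {v \<in> L. - v \<in> L}" "w \<in> {v \<in> L. - v \<in> L}"
    then show "v + w \<in> L" "- (v + w) \<in> L"
      using convex_cone_add[OF L, of v w] convex_cone_add[OF L, of "- v" "- w"] by auto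
  qed (use convex_cone_contains_0[OF L] in auto)
  have "active_values A C R J K \<subseteq> (+) z0 ` S"
  proof
    fix z assume "z \<in> active_values A C R J K"
    then obtain x and s :: "real^'m" where x: "z = (A *v x + s, C *v x)" "x \<in> R" "tangent_cone R x = K"
      and s: "{j. s $ j = 0} = J"
      by (auto simp: active_values_def)
    have eq: "s $ j = 0" "s0 $ j = 0" if "j \<in> J" for j
      using that s s0(2) by auto
    \<comment> \<open>Both base points have tangent cone \<open>K\<close>, so each sees the other in
      a direction of \<open>K\<close>. Since both slacks vanish on \<open>J\<close>,
      \<open>z - z0\<close> is a reversible direction.\<close>
    have dir: "x - x0 \<in> K" "x0 - x \<in> K"
      using diff_in_tangent_cone[OF x(2), of x0] diff_in_tangent_cone[OF x0(1), of x] x0(2) x(3) by auto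
    have "z - z0 \<in> L"
      unfolding L_def cone_image_def
      by (intro CollectI exI[of _ "x - x0"] exI[of _ "s - s0"])
        (use dir eq in \<open>auto simp: x z0_def matrix_vector_mult_diff_distrib\<close>)
    moreover have "- (z - z0) \<in> L"
      unfolding L_def cone_image_def
      by (intro CollectI exI[of _ "x0 - x"] exI[of _ "s0 - s"])
        (use dir eq in \<open>auto simp: x z0_def matrix_vector_mult_diff_distrib\<close>)
    ultimately show "z \<in> (+) z0 ` S"
      by (intro image_eqI[of _ _ "z - z0"]) (auto simp: S_def)
  qed
  then have "affine hull active_values A C R J K \<subseteq> (+) z0 ` S"
    by (rule hull_minimal) (simp add: affine_translation[symmetric] subspace_imp_affine \<open>subspace S\<close>)
  with span have D: "feasible_rhs A C R \<subseteq> (+) z0 ` S"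
    by blast
  \<comment> \<open>A small step from \<open>z0\<close> along any \<open>l\<close> in
    \<open>L\<close> stays feasible, so \<open>D\<close> puts a positive multiple of
    \<open>l\<close> into \<open>S\<close>.\<close>
  have "- l \<in> L" if l: "l \<in> L" for l
  proof -
    obtain v s where vs: "l = (A *v v + s, C *v v)" "v \<in> K" "\<forall>j\<in>J. 0 \<le> s $ j"
      using l by (auto simp: L_def cone_image_def)
    obtain t where t: "t > 0" "\<And>r. 0 \<le> r \<Longrightarrow> r \<le> t \<Longrightarrow> x0 + r *\<^sub>R v \<in> R"
      using tangent_cone_segment[OF polyhedron_imp_convex[OF R(1)] x0(1)] vs(2) x0(2) by metis
    \<comment> \<open>On \<open>J\<close> the slack \<open>s0\<close> is zero and \<open>s\<close>
      is nonnegative; off \<open>J\<close> the slack \<open>s0\<close> is positive and absorbs a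
      small step.\<close>
    have "\<forall>\<^sub>F r in at_right (0::real). 0 \<le> s0 $ j + r * s $ j" for j
    proof (cases "j \<in> J")
      case True
      then show ?thesis
        using eventually_at_right_less[of "0::real"] vs(3) s0(2) by (auto elim!: eventually_mono)
    next
      case False
      then have "0 < s0 $ j"
        using s0 by (auto simp: less_eq_vec_def less_le)
      moreover have "((\<lambda>r. s0 $ j + r * s $ j) \<longlongrightarrow> s0 $ j + 0 * s $ j) (at_right 0)"
        by (intro tendsto_intros)
      ultimately have "\<forall>\<^sub>F r in at_right (0::real). 0 < s0 $ j + r * s $ j"
        by (intro order_tendstoD(1)) auto
      then show ?thesis
        by (rule eventually_mono) simp
    qed
    then have "\<forall>\<^sub>F r in at_right (0::real). \<forall>j. 0 \<le> s0 $ j + r * s $ j"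
      by (rule eventually_all_finite)
    moreover have "\<forall>\<^sub>F r in at_right (0::real). r \<in> {0<..<t}"
      using t(1) by (rule eventually_at_right_real)
    ultimately have "\<forall>\<^sub>F r in at_right (0::real). (\<forall>j. 0 \<le> s0 $ j + r * s $ j) \<and> r \<in> {0<..<t}"
      by (rule eventually_conj)
    then obtain r where r: "\<forall>j. 0 \<le> s0 $ j + r * s $ j" "0 < r" "r < t"
      using eventually_happens'[OF trivial_limit_at_right_real] by fastforce
    have "z0 + r *\<^sub>R l \<in> feasible_rhs A C R"
      unfolding feasible_rhs_def
      by (intro CollectI exI[of _ "x0 + r *\<^sub>R v"] exI[of _ "s0 + r *\<^sub>R s"])
        (use r t(2)[of r] in \<open>auto simp: z0_def vs(1) matrix_vector_right_distrib
          matrix_vector_mult_scaleR scaleR_add_right less_eq_vec_def\<close>)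
    then have "r *\<^sub>R l \<in> S"
      using D by auto
    then have "(1 / r) *\<^sub>R (r *\<^sub>R l) \<in> S"
      by (rule subspace_scale[OF \<open>subspace S\<close>])
    then show ?thesis
      using r(2) by (simp add: S_def)
  qed
  then show ?thesis
    using L by (simp add: L_def subspace_convex_cone_symmetric)
qed

text \<open>The sets to avoid are the affine hulls of the active values of inadmissible pairs. They
  are finitely many, and by the spanning criterion none contains all feasible right-hand sides. Off
  these hulls, no feasible point can have an inadmissible pair.\<close>

lemma feasible_rhs_approx_generic:
  fixes A :: "real^'n^'m" and C :: "real^'n^'p"
  assumes R: "polyhedron R" and z: "z \<in> feasible_rhs A C R"
  obtains \<beta> \<delta> where "(\<lambda>k::nat. (\<beta> k, \<delta> k)) \<longlonglongrightarrow> z" "\<And>k. (\<beta> k, \<delta> k) \<in> feasible_rhs A C R"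
    "\<And>k x. x \<in> ineq_sols A (\<beta> k) \<inter> eq_sols C (\<delta> k) \<inter> R
       \<Longrightarrow> ({j. (A *v x) $ j = \<beta> k $ j}, tangent_cone R x) \<in> subspace_pairs A C R"
proof -
  define P where "P = {(J, K). K \<in> tangent_cones R \<and> \<not> subspace (cone_image A C J K)}"
  define \<V> where "\<V> = (\<lambda>(J, K). affine hull active_values A C R J K) ` P"
  have "P \<subseteq> UNIV \<times> tangent_cones R"
    by (auto simp: P_def)
  then have "finite P"
    by (rule finite_subset) (simp add: finite_tangent_cones[OF R])
  then have fin: "finite \<V>"
    by (simp add: \<V>_def)
  have ne: "R \<noteq> {}"
    using z by (auto simp: feasible_rhs_def)
  have aff: "affine V \<and> \<not> feasible_rhs A C R \<subseteq> V" if "V \<in> \<V>" for V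
    using that subspace_cone_image_if_spanning[OF R ne] by (auto simp: \<V>_def P_def)
  obtain \<zeta> where \<zeta>: "\<And>k::nat. \<zeta> k \<in> feasible_rhs A C R - \<Union>\<V>" "\<zeta> \<longlonglongrightarrow> z"
    using convex_approx_avoiding_affine[OF fin aff convex_feasible_rhs[OF polyhedron_imp_convex[OF R]] z]
    by blast
  show ?thesis
  proof (rule that[of "\<lambda>k. fst (\<zeta> k)" "\<lambda>k. snd (\<zeta> k)"])
    fix k x assume x: "x \<in> ineq_sols A (fst (\<zeta> k)) \<inter> eq_sols C (snd (\<zeta> k)) \<inter> R"
    let ?J = "{j. (A *v x) $ j = fst (\<zeta> k) $ j}"
    have "\<zeta> k \<in> affine hull active_values A C R ?J (tangent_cone R x)"
      using mem_active_values[OF x] by (simp add: hull_inc)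
    then have "(?J, tangent_cone R x) \<notin> P"
      using \<zeta>(1)[of k] by (auto simp: \<V>_def)
    then show "(?J, tangent_cone R x) \<in> subspace_pairs A C R"
      using x by (auto simp: P_def subspace_pairs_def tangent_cones_def)
  qed (use \<zeta> in auto)
qed

text \<open>A generic right-hand side has a feasible point, whose active set and tangent cone form
  an admissible pair. This secures that the outer maximum is attained.\<close>

lemma subspace_pairs_nonempty:
  fixes A :: "real^'n^'m" and C :: "real^'n^'p"
  assumes "polyhedron R" "R \<noteq> {}"
  shows "subspace_pairs A C R \<noteq> {}"
proof -
  obtain u where "u \<in> R"
    using assms(2) by auto
  then have "(A *v u + 0, C *v u) \<in> feasible_rhs A C R"
    unfolding feasible_rhs_def by blast
  then obtain \<beta> \<delta> where "(\<beta>, \<delta>) \<in> feasible_rhs A C R"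
    "\<And>x. x \<in> ineq_sols A \<beta> \<inter> eq_sols C \<delta> \<inter> R
       \<Longrightarrow> ({j. (A *v x) $ j = \<beta> $ j}, tangent_cone R x) \<in> subspace_pairs A C R"
    by (rule feasible_rhs_approx_generic[OF assms(1)]) blast
  then show ?thesis
    by (metis empty_iff equals0I mem_feasible_rhs_iff)
qed

section \<open>The error bound and its tightness\<close>

text \<open>
  Moving \<open>x\<close> along \<open>v\<close> overshoots the right-hand side \<open>(b, d)\<close>, away from that of \<open>u\<close>, so averaging
  with \<open>u\<close> restores feasibility.
\<close>

lemma nearest_sol_le_local_sol:
  fixes A :: "real^'n^'m" and C :: "real^'n^'p"
  assumes N: "is_norm N" and R: "convex R"
    and x: "x \<in> ineq_sols A b \<inter> eq_sols C d \<inter> R"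
    and nearest: "\<And>x'. x' \<in> ineq_sols A b \<inter> eq_sols C d \<inter> R \<Longrightarrow> N (u - x) \<le> N (u - x')"
    and u: "u \<in> R" and s: "0 \<le> s"
    and v: "v \<in> local_sols A C {j. (A *v x) $ j = b $ j} (tangent_cone R x) (b - A *v u - s, d - C *v u)"
  shows "N (u - x) \<le> N v"
proof -
  have Ax: "(A *v x) $ j \<le> b $ j" for j
    using x by (simp add: ineq_sols_def less_eq_vec_def)
  have xR: "x \<in> R" and Cx: "C *v x = d"
    using x by (auto simp: eq_sols_def)
  have vT: "v \<in> tangent_cone R x" and Cv: "C *v v = d - C *v u"
    and Av: "\<And>j. (A *v x) $ j = b $ j \<Longrightarrow> (A *v v) $ j \<le> b $ j - (A *v u) $ j - s $ j"
    using v by (auto simp: local_sols_def)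
  obtain t where t: "t > 0" "\<And>r. 0 \<le> r \<Longrightarrow> r \<le> t \<Longrightarrow> x + r *\<^sub>R v \<in> R"
    using tangent_cone_segment[OF R xR vT] by blast
  \<comment> \<open>Tight inequalities are handled by the local system that \<open>v\<close> solves,
    the others by their slack at \<open>x\<close>.\<close>
  have "\<forall>\<^sub>F r in at_right (0::real).
      (A *v x) $ j + r * (A *v v) $ j \<le> b $ j + r * (b $ j - (A *v u) $ j - s $ j)" for j
  proof (cases "(A *v x) $ j = b $ j")
    case True
    show ?thesis
      using eventually_at_right_less[of "0::real"]
      by (rule eventually_mono) (simp add: True Av mult_left_mono)
  next
    case False
    then have "0 < b $ j - (A *v x) $ j"
      using Ax[of j] by simp
    moreover have "((\<lambda>r. b $ j - (A *v x) $ j + r * (b $ j - (A *v u) $ j - s $ j - (A *v v) $ j)) \<longlongrightarrow>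
        b $ j - (A *v x) $ j + 0 * (b $ j - (A *v u) $ j - s $ j - (A *v v) $ j)) (at_right 0)"
      by (intro tendsto_intros)
    ultimately have "\<forall>\<^sub>F r in at_right (0::real).
        0 < b $ j - (A *v x) $ j + r * (b $ j - (A *v u) $ j - s $ j - (A *v v) $ j)"
      by (intro order_tendstoD(1)) auto
    then show ?thesis
      by (rule eventually_mono) (simp add: algebra_simps)
  qed
  then have "\<forall>\<^sub>F r in at_right (0::real). \<forall>j.
      (A *v x) $ j + r * (A *v v) $ j \<le> b $ j + r * (b $ j - (A *v u) $ j - s $ j)"
    by (rule eventually_all_finite)
  moreover have "\<forall>\<^sub>F r in at_right (0::real). r \<in> {0<..<t}"
    using t(1) by (rule eventually_at_right_real)
  ultimately have "\<forall>\<^sub>F r in at_right (0::real). (\<forall>j.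
      (A *v x) $ j + r * (A *v v) $ j \<le> b $ j + r * (b $ j - (A *v u) $ j - s $ j)) \<and> r \<in> {0<..<t}"
    by (rule eventually_conj)
  then obtain r where rA: "\<And>j. (A *v x) $ j + r * (A *v v) $ j \<le> b $ j + r * (b $ j - (A *v u) $ j - s $ j)"
    and r: "0 < r" "r < t"
    using eventually_happens'[OF trivial_limit_at_right_real] by fastforce
  \<comment> \<open>The weights \<open>p\<close> and \<open>p * r\<close> sum to 1, so
    \<open>x'\<close> below is the convex combination
    \<open>(x + r v + r u) / (1 + r)\<close>.\<close>
  define p where "p = 1 / (1 + r)"
  have p: "p > 0" "p + p * r = 1"
    using r(1) by (auto simp: p_def field_simps)
  define x' where "x' = p *\<^sub>R (x + r *\<^sub>R v) + (p * r) *\<^sub>R u"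
  have "x' \<in> R"
    unfolding x'_def using p r t(2)[of r] u by (intro convexD[OF R]) auto
  moreover have "A *v x' \<le> b"
    unfolding less_eq_vec_def
  proof
    fix j
    have "(A *v x') $ j = p * ((A *v x) $ j + r * (A *v v) $ j + r * (A *v u) $ j)"
      by (simp add: x'_def matrix_vector_right_distrib matrix_vector_mult_scaleR algebra_simps)
    also have "\<dots> \<le> p * ((1 + r) * b $ j)"
    proof (rule mult_left_mono)
      have "0 \<le> r * s $ j"
        using r(1) s by (simp add: less_eq_vec_def)
      then show "(A *v x) $ j + r * (A *v v) $ j + r * (A *v u) $ j \<le> (1 + r) * b $ j"
        using rA[of j] by (simp add: algebra_simps)
    qed (use p in simp)
    also have "\<dots> = (p + p * r) * b $ j"
      by (simp add: algebra_simps)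
    also have "\<dots> = b $ j"
      using p(2) by simp
    finally show "(A *v x') $ j \<le> b $ j" .
  qed
  moreover have "C *v x' = d"
  proof -
    have "C *v x' = (p + p * r) *\<^sub>R d"
      by (simp add: x'_def matrix_vector_right_distrib matrix_vector_mult_scaleR Cx Cv algebra_simps)
    then show ?thesis
      using p(2) by simp
  qed
  ultimately have "N (u - x) \<le> N (u - x')"
    by (intro nearest) (simp add: ineq_sols_def eq_sols_def)
  \<comment> \<open>Writing \<open>u\<close> with total weight \<open>p + p * r\<close> cancels its
    share in \<open>x'\<close>. The triangle inequality then lets one copy of
    \<open>N (u - x)\<close> be subtracted from both sides.\<close>
  also have "u - x' = p *\<^sub>R ((u - x) + (- r) *\<^sub>R v)"
  proof -
    have "u - x' = (p + p * r) *\<^sub>R u - x'"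
      using p(2) by simp
    also have "\<dots> = p *\<^sub>R ((u - x) + (- r) *\<^sub>R v)"
      by (simp add: x'_def algebra_simps)
    finally show ?thesis .
  qed
  also have "N \<dots> = p * N ((u - x) + (- r) *\<^sub>R v)"
    using p(1) by (simp only: is_norm_scaleR[OF N])
  also have "\<dots> \<le> p * (N (u - x) + r * N v)"
    using is_norm_triangle[OF N, of "u - x" "(- r) *\<^sub>R v"] p(1) r(1)
    by (simp only: is_norm_scaleR[OF N]) (simp add: mult_left_mono)
  finally have "(1 + r) * N (u - x) \<le> N (u - x) + r * N v"
    using r(1) by (simp add: p_def field_simps)
  then show ?thesis
    using r(1) by (simp add: algebra_simps)
qed

lemma nearest_sol_le_hoffman_const:
  fixes A :: "real^'n^'m" and C :: "real^'n^'p"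
  assumes N: "is_norm N" and M: "is_norm M" and R: "polyhedron R"
    and x: "x \<in> ineq_sols A b \<inter> eq_sols C d \<inter> R"
    and nearest: "\<And>x'. x' \<in> ineq_sols A b \<inter> eq_sols C d \<inter> R \<Longrightarrow> N (u - x) \<le> N (u - x')"
    and u: "u \<in> R" and s: "0 \<le> s"
    and pair: "({j. (A *v x) $ j = b $ j}, tangent_cone R x) \<in> subspace_pairs A C R"
  shows "N (u - x) \<le> hoffman_const N M A C R * M (b - A *v u - s, d - C *v u)"
proof -
  let ?J = "{j. (A *v x) $ j = b $ j}"
  let ?L = "cone_image A C ?J (tangent_cone R x)"
  have sub: "subspace ?L"
    using pair by (simp add: subspace_pairs_def)
  \<comment> \<open>The negated residual comes from the direction \<open>u - x\<close> with slack
    \<open>A x + s - b\<close>, which equals \<open>s\<close> on the active set. The subspace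
    property supplies the residual itself, making the local system solvable.\<close>
  have "- (b - A *v u - s, d - C *v u) \<in> ?L"
    unfolding cone_image_def
    by (intro CollectI exI[of _ "u - x"] exI[of _ "A *v x + s - b"])
      (use x u s in \<open>auto simp: matrix_vector_mult_diff_distrib eq_sols_def less_eq_vec_def
        intro!: diff_in_tangent_cone\<close>)
  from subspace_neg[OF sub this] have mem: "(b - A *v u - s, d - C *v u) \<in> ?L"
    by simp
  obtain v where "v \<in> local_sols A C ?J (tangent_cone R x) (b - A *v u - s, d - C *v u)"
    and "N v \<le> hoffman_const N M A C R * M (b - A *v u - s, d - C *v u)"
    using local_sol_le_hoffman_const[OF N M R pair mem] .
  with nearest_sol_le_local_sol[OF N polyhedron_imp_convex[OF R] x nearest u s] show ?thesis
    by force
qed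

section \<open>The bound for all feasible right-hand sides, by passage to the limit\<close>

lemma closed_feasible_set:
  assumes "polyhedron R"
  shows "closed (ineq_sols A b \<inter> eq_sols C d \<inter> R)"
proof -
  have "ineq_sols A b \<inter> eq_sols C d \<inter> R = local_sols A C UNIV R (b, d)"
    by (auto simp: ineq_sols_def eq_sols_def local_sols_def less_eq_vec_def)
  then show ?thesis
    using closed_local_sols[OF polyhedron_imp_closed[OF assms]] by metis
qed

lemma closed_nonneg_Times_zero: "closed ({s. 0 \<le> s} \<times> {0} :: ((real^'m) \<times> (real^'p)) set)"
proof -
  have "{s :: real^'m. 0 \<le> s} = (\<Inter>j. {s. 0 \<le> s $ j})"
    by (auto simp: less_eq_vec_def)
  moreover have "closed {s :: real^'m. 0 \<le> s $ j}" for j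
    by (intro closed_Collect_le continuous_intros)
  ultimately show ?thesis
    by (intro closed_Times) (simp_all add: closed_INT)
qed

lemma hoffman_bound:
  fixes A :: "real^'n^'m" and C :: "real^'n^'p"
  assumes N: "is_norm N" and M: "is_norm M" and R: "polyhedron R"
    and bd: "(b, d) \<in> feasible_rhs A C R" and u: "u \<in> R"
  shows "set_dist N u (ineq_sols A b \<inter> eq_sols C d \<inter> R)
    \<le> hoffman_const N M A C R * set_dist M (b - A *v u, d - C *v u) ({s. 0 \<le> s} \<times> {0})"
proof -
  define H where "H = hoffman_const N M A C R"
  let ?S = "{s. 0 \<le> s} \<times> {0} :: ((real^'m) \<times> (real^'p)) set"
  have "?S \<noteq> {}"
    by auto
  \<comment> \<open>The point of the cone nearest to the residual of \<open>(b, d)\<close> is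
    \<open>(s, 0)\<close>; this \<open>s\<close> stays fixed along the approximating sequence, so
    that the bounds converge to the desired one.\<close>
  then obtain q where "q \<in> ?S"
    "set_dist M (b - A *v u, d - C *v u) ?S = M ((b - A *v u, d - C *v u) - q)"
    using set_dist_attained[OF M closed_nonneg_Times_zero] by metis
  then obtain s where s: "0 \<le> s"
    and dist: "set_dist M (b - A *v u, d - C *v u) ?S = M (b - A *v u - s, d - C *v u)"
    by auto
  obtain \<beta> \<delta> where lim: "(\<lambda>k::nat. (\<beta> k, \<delta> k)) \<longlonglongrightarrow> (b, d)"
    and feas: "\<And>k. (\<beta> k, \<delta> k) \<in> feasible_rhs A C R"
    and generic: "\<And>k x. x \<in> ineq_sols A (\<beta> k) \<inter> eq_sols C (\<delta> k) \<inter> R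
       \<Longrightarrow> ({j. (A *v x) $ j = \<beta> k $ j}, tangent_cone R x) \<in> subspace_pairs A C R"
    using feasible_rhs_approx_generic[OF R bd] by blast
  have "\<exists>x. x \<in> ineq_sols A (\<beta> k) \<inter> eq_sols C (\<delta> k) \<inter> R
      \<and> N (u - x) \<le> H * M (\<beta> k - A *v u - s, \<delta> k - C *v u)" for k
  proof -
    have ne: "ineq_sols A (\<beta> k) \<inter> eq_sols C (\<delta> k) \<inter> R \<noteq> {}"
      using feas[of k] by (simp only: mem_feasible_rhs_iff) simp
    obtain x where x: "x \<in> ineq_sols A (\<beta> k) \<inter> eq_sols C (\<delta> k) \<inter> R"
      and nearest: "\<And>x'. x' \<in> ineq_sols A (\<beta> k) \<inter> eq_sols C (\<delta> k) \<inter> R \<Longrightarrow> N (u - x) \<le> N (u - x')"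
      using set_dist_attained[OF N closed_feasible_set[OF R] ne, of u] by blast
    show ?thesis
      using nearest_sol_le_hoffman_const[OF N M R x nearest u s generic[OF x]] x unfolding H_def by blast
  qed
  then obtain \<xi> where \<xi>: "\<And>k. \<xi> k \<in> ineq_sols A (\<beta> k) \<inter> eq_sols C (\<delta> k) \<inter> R"
    and \<xi>_le: "\<And>k. N (u - \<xi> k) \<le> H * M (\<beta> k - A *v u - s, \<delta> k - C *v u)"
    by metis
  have \<beta>: "\<beta> \<longlonglongrightarrow> b" and \<delta>: "\<delta> \<longlonglongrightarrow> d"
    using tendsto_fst[OF lim] tendsto_snd[OF lim] by auto
  have contM: "isCont M z" for z
    using continuous_on_is_norm[OF M, of UNIV] by (simp only: continuous_on_eq_continuous_at[OF open_UNIV]) blast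
  have contN: "isCont N y" for y
    using continuous_on_is_norm[OF N, of UNIV] by (simp only: continuous_on_eq_continuous_at[OF open_UNIV]) blast
  have limM: "(\<lambda>k. H * M (\<beta> k - A *v u - s, \<delta> k - C *v u)) \<longlonglongrightarrow> H * M (b - A *v u - s, d - C *v u)"
    by (intro tendsto_mult tendsto_const isCont_tendsto_compose[OF contM] tendsto_Pair tendsto_diff \<beta> \<delta>)
  \<comment> \<open>The convergent bounds are bounded by some \<open>B\<close>, which confines all
    nearest points \<open>\<xi> k\<close> to one compact ball. A cluster point of them is feasible
    for \<open>(b, d)\<close> and inherits the estimate.\<close>
  from convergent_imp_Bseq[OF convergentI[OF this]]
  obtain B where B: "\<forall>k. norm (H * M (\<beta> k - A *v u - s, \<delta> k - C *v u)) \<le> B"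
    unfolding Bseq_def by blast
  have "\<xi> k \<in> {x. N (u - x) \<le> B}" for k
    using order_trans[OF \<xi>_le abs_le_D1[OF B[rule_format, unfolded real_norm_def]]] by simp
  then obtain x and r :: "nat \<Rightarrow> nat" where r: "strict_mono r" and "(\<xi> \<circ> r) \<longlonglongrightarrow> x"
    using compact_is_norm_cball[OF N, of u B, unfolded compact_def, rule_format, of \<xi>] by blast
  then have \<xi>x: "(\<lambda>k. \<xi> (r k)) \<longlonglongrightarrow> x"
    by (simp add: o_def)
  note sub = LIMSEQ_subseq_LIMSEQ[OF _ r, unfolded o_def]
  note lin = bounded_linear.tendsto[OF matrix_vector_mul_bounded_linear \<xi>x]
  have "x \<in> R"
    by (rule closed_sequentially[OF polyhedron_imp_closed[OF R] _ \<xi>x]) (use \<xi> in auto)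
  moreover have "(A *v x) $ j \<le> b $ j" for j
  proof (rule LIMSEQ_le)
    show "(\<lambda>k. (A *v \<xi> (r k)) $ j) \<longlonglongrightarrow> (A *v x) $ j"
      by (intro tendsto_vec_nth lin)
    show "(\<lambda>k. \<beta> (r k) $ j) \<longlonglongrightarrow> b $ j"
      by (intro tendsto_vec_nth sub \<beta>)
    show "\<exists>n0. \<forall>k\<ge>n0. (A *v \<xi> (r k)) $ j \<le> \<beta> (r k) $ j"
      using \<xi> by (auto simp: ineq_sols_def less_eq_vec_def)
  qed
  moreover have "C *v x = d"
  proof (rule LIMSEQ_unique)
    show "(\<lambda>k. C *v \<xi> (r k)) \<longlonglongrightarrow> C *v x"
      by (rule lin)
    have "C *v \<xi> (r k) = \<delta> (r k)" for k
      using \<xi>[of "r k"] by (simp add: eq_sols_def)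
    then show "(\<lambda>k. C *v \<xi> (r k)) \<longlonglongrightarrow> d"
      using sub[OF \<delta>] by simp
  qed
  ultimately have "set_dist N u (ineq_sols A b \<inter> eq_sols C d \<inter> R) \<le> N (u - x)"
    by (intro set_dist_le[OF N closed_feasible_set[OF R]])
      (simp add: ineq_sols_def eq_sols_def less_eq_vec_def)
  also have "\<dots> \<le> H * M (b - A *v u - s, d - C *v u)"
  proof (rule LIMSEQ_le)
    show "(\<lambda>k. N (u - \<xi> (r k))) \<longlonglongrightarrow> N (u - x)"
      by (intro isCont_tendsto_compose[OF contN] tendsto_diff tendsto_const \<xi>x)
    show "(\<lambda>k. H * M (\<beta> (r k) - A *v u - s, \<delta> (r k) - C *v u)) \<longlonglongrightarrow> H * M (b - A *v u - s, d - C *v u)"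
      by (rule sub[OF limM])
  qed (use \<xi>_le in blast)
  finally show ?thesis
    by (simp add: dist H_def)
qed

section \<open>Tightness\<close>

lemma hoffman_bound_tight:
  fixes A :: "real^'n^'m" and C :: "real^'n^'p"
  assumes N: "is_norm N" and M: "is_norm M" and R: "polyhedron R" "R \<noteq> {}"
    and pos: "hoffman_const N M A C R > 0"
  obtains b d u where "(b, d) \<in> feasible_rhs A C R" "u \<in> R"
    "set_dist N u (ineq_sols A b \<inter> eq_sols C d \<inter> R)
      = hoffman_const N M A C R * set_dist M (b - A *v u, d - C *v u) ({s. 0 \<le> s} \<times> {0})"
    "set_dist N u (ineq_sols A b \<inter> eq_sols C d \<inter> R) > 0"
proof -
  define H where "H = hoffman_const N M A C R"
  have "H \<in> (\<lambda>(J, K). max_min_norm_sol N M A C J K) ` subspace_pairs A C R"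
    unfolding H_def hoffman_const_def
    by (rule Max_in) (use finite_subspace_pairs[OF R(1)] subspace_pairs_nonempty[OF R] in auto)
  then obtain J K where JK: "(J, K) \<in> subspace_pairs A C R" and H: "H = max_min_norm_sol N M A C J K"
    by auto
  note K = subspace_pairs_closed[OF R(1) JK] subspace_pairs_convex_cone[OF R(1) JK]
  have sub: "subspace (cone_image A C J K)"
    using JK by (simp add: subspace_pairs_def)
  obtain u where u: "u \<in> R" "K = tangent_cone R u"
    using JK by (auto simp: subspace_pairs_def tangent_cones_def)
  obtain z where z: "z \<in> cone_image A C J K" "M z \<le> 1" "H = min_norm_sol N A C J K z"
    using max_min_norm_sol_attained[OF N M K sub] unfolding H by metis
  obtain v where v: "v \<in> local_sols A C J K z" and Nv: "N v = H"
    using min_norm_sol_attained[OF N K(1) z(1)] unfolding z(3) by metis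
  obtain y w where yw: "z = (y, w)"
    by force
  have vK: "v \<in> tangent_cone R u" and Cv: "C *v v = w" and Av: "\<And>j. j \<in> J \<Longrightarrow> (A *v v) $ j \<le> y $ j"
    using v u(2) by (auto simp: local_sols_def yw)
  obtain t where t: "t > 0" "u + t *\<^sub>R v \<in> R"
    using vK by (auto simp: tangent_cone_def)
  \<comment> \<open>Relaxes the inequalities outside \<open>J\<close> just enough for
    \<open>v\<close> to satisfy all of them, and leaves those in \<open>J\<close> unchanged.\<close>
  define s :: "real^'m" where "s = (\<chi> j. if j \<in> J then 0 else max 0 ((A *v v) $ j - y $ j))"
  have s: "0 \<le> s" "\<And>j. j \<in> J \<Longrightarrow> s $ j = 0"
    by (auto simp: s_def less_eq_vec_def)
  have Avs: "(A *v v) $ j \<le> y $ j + s $ j" for j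
    using Av[of j] by (auto simp: s_def)
  define b where "b = A *v u + t *\<^sub>R (y + s)"
  define d where "d = C *v u + t *\<^sub>R w"
  define F where "F = ineq_sols A b \<inter> eq_sols C d \<inter> R"
  have "(A *v (u + t *\<^sub>R v)) $ j \<le> b $ j" for j
    using mult_left_mono[OF Avs, of t j] t(1)
    by (simp add: b_def matrix_vector_right_distrib matrix_vector_mult_scaleR)
  then have uv: "u + t *\<^sub>R v \<in> F"
    using t(2) Cv
    by (simp add: F_def ineq_sols_def eq_sols_def less_eq_vec_def d_def
        matrix_vector_right_distrib matrix_vector_mult_scaleR)
  \<comment> \<open>For feasible \<open>x\<close>, the scaled difference \<open>(x - u) / t\<close>
    solves the local system for \<open>z\<close>, so its norm is at least the minimum
    \<open>H\<close>.\<close>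
  have lower: "t * H \<le> N (u - x)" if x: "x \<in> F" for x
  proof -
    define v' where "v' = (1 / t) *\<^sub>R (x - u)"
    have "v' \<in> K"
      unfolding v'_def u(2) using t(1) x
      by (intro convex_cone_scaleR[OF convex_cone_tangent_cone[OF R(1) u(1)]] diff_in_tangent_cone)
        (auto simp: F_def)
    moreover have "(A *v v') $ j \<le> y $ j" if j: "j \<in> J" for j
    proof -
      have "(A *v x) $ j \<le> (A *v u) $ j + t * y $ j"
        using x s(2)[OF j] by (auto simp: F_def ineq_sols_def b_def less_eq_vec_def dest: spec[of _ j])
      then show ?thesis
        using t(1) by (simp add: v'_def matrix_vector_mult_scaleR matrix_vector_mult_diff_distrib field_simps)
    qed
    moreover have "C *v v' = w"
      using x t(1)
      by (simp add: v'_def F_def eq_sols_def d_def matrix_vector_mult_scaleR matrix_vector_mult_diff_distrib)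
    ultimately have "v' \<in> local_sols A C J K z"
      by (simp add: local_sols_def yw)
    then have "H \<le> N v'"
      using min_norm_sol_le[OF N K(1)] z(3) by metis
    also have "N v' = N (u - x) / t"
      using t(1) by (simp add: v'_def is_norm_scaleR[OF N] is_norm_minus_commute[OF N, of x])
    finally show ?thesis
      using t(1) by (simp add: field_simps)
  qed
  have F: "closed F"
    unfolding F_def by (rule closed_feasible_set[OF R(1)])
  obtain x where "x \<in> F" "set_dist N u F = N (u - x)"
    using set_dist_attained[OF N F] uv by (metis empty_iff)
  then have dist: "t * H \<le> set_dist N u F"
    using lower by simp
  let ?S = "{s. 0 \<le> s} \<times> {0} :: ((real^'m) \<times> (real^'p)) set"
  \<comment> \<open>Subtracting the cone point \<open>(t s, 0)\<close> from the residual leaves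
    \<open>t z\<close>, whose \<open>M\<close>-norm is at most \<open>t\<close>.\<close>
  have "set_dist M (b - A *v u, d - C *v u) ?S \<le> M ((b - A *v u, d - C *v u) - (t *\<^sub>R s, 0))"
    by (intro set_dist_le[OF M closed_nonneg_Times_zero])
      (use s(1) t(1) in \<open>auto simp: less_eq_vec_def\<close>)
  also have "(b - A *v u, d - C *v u) - (t *\<^sub>R s, 0) = t *\<^sub>R z"
    by (simp add: b_def d_def yw scaleR_add_right)
  also have "M (t *\<^sub>R z) \<le> t"
    using t(1) z(2) by (simp add: is_norm_scaleR[OF M])
  finally have "H * set_dist M (b - A *v u, d - C *v u) ?S \<le> t * H"
    using pos by (simp add: H_def mult.commute)
  moreover have bd: "(b, d) \<in> feasible_rhs A C R"
    using uv unfolding mem_feasible_rhs_iff F_def by blast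
  moreover have "set_dist N u F \<le> H * set_dist M (b - A *v u, d - C *v u) ?S"
    unfolding F_def H_def by (rule hoffman_bound[OF N M R(1) bd u(1)])
  \<comment> \<open>The error bound closes the cycle: \<open>H\<close> times the residual distance
    is at most \<open>t * H\<close>, which is at most the distance to \<open>F\<close>, which is at
    most \<open>H\<close> times the residual distance.\<close>
  ultimately have "set_dist N u F = H * set_dist M (b - A *v u, d - C *v u) ?S"
    using dist by linarith
  moreover have "set_dist N u F > 0"
    using dist mult_pos_pos[OF t(1) pos] by (simp add: H_def)
  ultimately show ?thesis
    using that[OF bd u(1)] by (simp add: F_def H_def)
qed

theorem proposition5:
  fixes A :: "real^'n^'m" and C :: "real^'n^'p" and R :: "(real^'n) set"
    and N :: "real^'n \<Rightarrow> real" and M :: "(real^'m) \<times> (real^'p) \<Rightarrow> real"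
  assumes "is_norm N" and "is_norm M"
    and "polyhedron R" and "R \<noteq> {}"
  shows "(\<forall>b d u. (b, d) \<in> feasible_rhs A C R \<and> u \<in> R \<longrightarrow>
            set_dist N u (ineq_sols A b \<inter> eq_sols C d \<inter> R)
              \<le> hoffman_const N M A C R * set_dist M (b - A *v u, d - C *v u) ({s. 0 \<le> s} \<times> {0}))
       \<and> (hoffman_const N M A C R > 0 \<longrightarrow>
            (\<exists>b d u. (b, d) \<in> feasible_rhs A C R \<and> u \<in> R \<and>
              set_dist N u (ineq_sols A b \<inter> eq_sols C d \<inter> R)
                = hoffman_const N M A C R * set_dist M (b - A *v u, d - C *v u) ({s. 0 \<le> s} \<times> {0}) \<and>
              hoffman_const N M A C R * set_dist M (b - A *v u, d - C *v u) ({s. 0 \<le> s} \<times> {0}) > 0))"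
proof (intro conjI allI impI)
  fix b d u assume "(b, d) \<in> feasible_rhs A C R \<and> u \<in> R"
  then show "set_dist N u (ineq_sols A b \<inter> eq_sols C d \<inter> R)
      \<le> hoffman_const N M A C R * set_dist M (b - A *v u, d - C *v u) ({s. 0 \<le> s} \<times> {0})"
    using hoffman_bound[OF assms(1-3)] by blast
next
  assume "hoffman_const N M A C R > 0"
  from hoffman_bound_tight[OF assms this]
  obtain b d u where "(b, d) \<in> feasible_rhs A C R" "u \<in> R"
    and eq: "set_dist N u (ineq_sols A b \<inter> eq_sols C d \<inter> R)
      = hoffman_const N M A C R * set_dist M (b - A *v u, d - C *v u) ({s. 0 \<le> s} \<times> {0})"
    and "set_dist N u (ineq_sols A b \<inter> eq_sols C d \<inter> R) > 0" .
  then show "\<exists>b d u. (b, d) \<in> feasible_rhs A C R \<and> u \<in> R \<and>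
      set_dist N u (ineq_sols A b \<inter> eq_sols C d \<inter> R)
        = hoffman_const N M A C R * set_dist M (b - A *v u, d - C *v u) ({s. 0 \<le> s} \<times> {0}) \<and>
      hoffman_const N M A C R * set_dist M (b - A *v u, d - C *v u) ({s. 0 \<le> s} \<times> {0}) > 0"
    by metis
qed

end
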